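(* The double Geronimus polynomials satisfy a five-term recurrence relation $$(x-a)^2P_n^{gg}(x)=P_{n+2}^{gg}(x)+\alpha_{n+1,n+1}^{gg}P_{n+1}^{gg}(x)+\alpha_{n+1,n}^{gg}P_n^{gg}(x)+\alpha_{n+1,n-1}^{gg}P_{n-1}^{gg}(x)+\alpha_{n+1,n-2}^{gg}P_{n-2}^{gg}(x),\qquad n\ge0,$$ with real coefficients given by $$\alpha_{n+1,n+1}^{gg}=\frac{C_{n+1}B_n\lVert P_{n-1}\rVert_0^2+B_{n+1}\lVert P_n\rVert_0^2}{C_{n+1}\lVert P_{n-1}\rVert_0^2}\ (n\ge1),\qquad \alpha_{n+1,n}^{gg}=\frac{\lVert P_n\rVert_0^2+B_n^2\lVert P_{n-1}\rVert_0^2+C_n^2\lVert P_{n-2}\rVert_0^2}{C_n\lVert P_{n-2}\rVert_0^2}\ (n\ge2),$$ $$\alpha_{n+1,n-1}^{gg}=\frac{B_n\lVert P_{n-1}\rVert_0^2+B_{n-1}C_n\lVert P_{n-2}\rVert_0^2}{C_{n-1}\lVert P_{n-3}\rVert_0^2}\ (n\ge3),\qquad \alpha_{n+1,n-2}^{gg}=\frac{C_n\lVert P_{n-2}\rVert_0^2}{C_{n-2}\lVert P_{n-4}\rVert_0^2}\ (n\ge4).$$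
   Context: Let $\mu$ be a positive Borel measure on $\mathbb{R}$ with infinite support $E=\operatorname{supp}(\mu)$ and finite moments of all orders, and let $a\in\mathbb{R}\setminus E$. Put $\langle p,q\rangle_0=\int_E p(x)q(x)\,d\mu(x)$ and $\lVert p\rVert_0^2=\langle p,p\rangle_0$. Let $\{P_n\}_{n\ge0}$ be the monic orthogonal polynomials with respect to $\langle\cdot,\cdot\rangle_0$ (with $P_{-1}=0$). Define $\mu_{gg}$ by $(x-a)^2\,d\mu_{gg}(x)=d\mu(x)$ and, for real numbers $b,c,d$, define on real polynomials $$\langle p,q\rangle_{gg}=\int_E p(x)q(x)\,d\mu_{gg}(x)+\begin{bmatrix}p(a)&p'(a)\end{bmatrix}\mathbf{M}_1\begin{bmatrix}q(a)\\ q'(a)\end{bmatrix},\qquad \mathbf{M}_1=\begin{bmatrix}b&c\\ c&d\end{bmatrix}-\begin{bmatrix}\int_E d\mu_{gg}&\int_E x\,d\mu_{gg}\\ \int_E x\,d\mu_{gg}&\int_E x^2\,d\mu_{gg}\end{bmatrix}.$$ Thus $\langle (x-a)^2p,q\rangle_{gg}=\langle p,q\rangle_0$ for all polynomials $p,q$. It is assumed that there is a sequence $\{P_n^{gg}\}_{n\ge0}$ of monic polynomials, $\deg P_n^{gg}=n$, orthogonal with respect to $\langle\cdot,\cdot\rangle_{gg}$ with $\langle P_n^{gg},P_n^{gg}\rangle_{gg}\ne 0$; these are the double Geronimus polynomials. They satisfy $P_n^{gg}=P_n+B_nP_{n-1}+C_nP_{n-2}$ for $n\ge1$ with real $B_n,C_n$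 and $C_n\ne0$ for $n\ge2$; by convention $P_{-1}^{gg}=P_{-2}^{gg}=0$, $B_0=C_0=C_1=0$. *)

theory Defs
  imports "HOL-Analysis.Analysis" "HOL-Computational_Algebra.Polynomial"
begin

definition measure_support :: "'a::topological_space measure \<Rightarrow> 'a set" where
  "measure_support M = {x. \<forall>U. open U \<and> x \<in> U \<longrightarrow> emeasure M U > 0}"

definition inner0 :: "real measure \<Rightarrow> real poly \<Rightarrow> real poly \<Rightarrow> real" where
  "inner0 \<mu> p q = (LINT x:measure_support \<mu>|\<mu>. poly p x * poly q x)"

definition sqnorm0 :: "real measure \<Rightarrow> real poly \<Rightarrow> real" where
  "sqnorm0 \<mu> p = inner0 \<mu> p p"

definition M1 :: "real set \<Rightarrow> real measure \<Rightarrow> real \<Rightarrow> real \<Rightarrow> real \<Rightarrow> real^2^2" where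
  "M1 E \<mu>gg b c d =
     vector [vector [b, c], vector [c, d]] -
     vector [vector [(LINT x:E|\<mu>gg. 1), (LINT x:E|\<mu>gg. x)],
             vector [(LINT x:E|\<mu>gg. x), (LINT x:E|\<mu>gg. x\<^sup>2)]]"

definition inner_gg ::
  "real set \<Rightarrow> real measure \<Rightarrow> real \<Rightarrow> real \<Rightarrow> real \<Rightarrow> real \<Rightarrow> real poly \<Rightarrow> real poly \<Rightarrow> real" where
  "inner_gg E \<mu>gg a b c d p q =
     (LINT x:E|\<mu>gg. poly p x * poly q x) +
     (vector [poly p a, poly (pderiv p) a] :: real^2) \<bullet>
       (M1 E \<mu>gg b c d *v vector [poly q a, poly (pderiv q) a])"

definition monic_orthogonal ::
  "(real poly \<Rightarrow> real poly \<Rightarrow> real) \<Rightarrow> (nat \<Rightarrow> real poly) \<Rightarrow> bool" where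
  "monic_orthogonal f P \<longleftrightarrow>
     (\<forall>n. degree (P n) = n \<and> lead_coeff (P n) = 1) \<and>
     (\<forall>m n. m \<noteq> n \<longrightarrow> f (P m) (P n) = 0)"

text \<open>A sequence of polynomials is extended to negative indices by zero, which realises
  the conventions for the indices \<open>-1\<close> and \<open>-2\<close>.\<close>
definition zero_ext :: "(nat \<Rightarrow> real poly) \<Rightarrow> int \<Rightarrow> real poly" where
  "zero_ext P k = (if k < 0 then 0 else P (nat k))"

definition connection_coeffs ::
  "(nat \<Rightarrow> real poly) \<Rightarrow> (nat \<Rightarrow> real poly) \<Rightarrow> (nat \<Rightarrow> real) \<Rightarrow> (nat \<Rightarrow> real) \<Rightarrow> bool" where
  "connection_coeffs P Pgg B C \<longleftrightarrow>
     (\<forall>n\<ge>1. Pgg n = P n + smult (B n) (zero_ext P (int n - 1))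
                         + smult (C n) (zero_ext P (int n - 2))) \<and>
     (\<forall>n\<ge>2. C n \<noteq> 0) \<and> B 0 = 0 \<and> C 0 = 0 \<and> C 1 = 0"

end

theory Submission
  imports Defs
begin

text \<open>Write \<open>w = (x - a)\<^sup>2\<close>. Both \<open>w\<close> and its derivative vanish at \<open>a\<close>, so the mass-point part of
  the Geronimus form does not see multiples of \<open>w\<close>, and \<open>w d\<mu>\<^sub>g\<^sub>g = d\<mu>\<close> gives
  \<open>\<langle>w p, q\<rangle>\<^sub>g\<^sub>g = \<langle>p, q\<rangle>\<^sub>0\<close> (lemma \<open>inner_gg_square_factor\<close>). Everything else is linear algebra in
  two symmetric forms linked by this identity. Bilinearity of the Geronimus form needs polynomials
  to be integrable over \<open>E\<close> against \<open>\<mu>\<^sub>g\<^sub>g\<close>; this holds because \<open>E\<close> is closed and misses \<open>a\<close>, so that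
  \<open>1 / w\<close> is bounded on \<open>E\<close>.

  Expand \<open>w P\<^sub>n\<^sup>g\<^sup>g\<close> in the basis \<open>P\<^sub>k\<^sup>g\<^sup>g\<close>. The coefficient at \<open>k\<close> is
  \<open>\<langle>w P\<^sub>n\<^sup>g\<^sup>g, P\<^sub>k\<^sup>g\<^sup>g\<rangle>\<^sub>g\<^sub>g = \<langle>P\<^sub>n\<^sup>g\<^sup>g, P\<^sub>k\<^sup>g\<^sup>g\<rangle>\<^sub>0\<close> divided by \<open>\<langle>P\<^sub>k\<^sup>g\<^sup>g, P\<^sub>k\<^sup>g\<^sup>g\<rangle>\<^sub>g\<^sub>g\<close>. By symmetry the numerator
  is also \<open>\<langle>P\<^sub>n\<^sup>g\<^sup>g, w P\<^sub>k\<^sup>g\<^sup>g\<rangle>\<^sub>g\<^sub>g\<close>, which vanishes for \<open>k + 2 < n\<close>; hence five terms. The connection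
  formula writes \<open>P\<^sub>n\<^sup>g\<^sup>g\<close> and \<open>P\<^sub>k\<^sup>g\<^sup>g\<close> through three consecutive \<open>P\<^sub>j\<close> each, which evaluates the
  numerator. The denominator is \<open>C\<^sub>k \<parallel>P\<^bsub>k-2\<^esub>\<parallel>\<^sub>0\<^sup>2\<close> for \<open>k \<ge> 2\<close>, because \<open>P\<^sub>k\<^sup>g\<^sup>g\<close> may be replaced in one
  argument by the monic polynomial \<open>w P\<^bsub>k-2\<^esub>\<close> of the same degree.\<close>

section \<open>Orthogonal expansions for symmetric forms on polynomials\<close>

lemma monic_sequence_spans:
  fixes P :: "nat \<Rightarrow> 'a::comm_ring_1 poly"
  assumes deg: "\<And>n. degree (P n) = n" and lead: "\<And>n. lead_coeff (P n) = 1"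
    and "degree p \<le> N"
  shows "\<exists>c. p = (\<Sum>k\<le>N. smult (c k) (P k))"
  using \<open>degree p \<le> N\<close>
proof (induction N arbitrary: p)
  case 0
  have const: "q = [:coeff q 0:]" if "degree q = 0" for q :: "'a poly"
    using degree_0_id[OF that] by simp
  have "coeff (P 0) 0 = 1"
    using lead[of 0] deg[of 0] by simp
  then have "P 0 = 1"
    using const[of "P 0"] deg[of 0] by (simp add: one_pCons)
  then have "p = (\<Sum>k\<le>0. smult (coeff p 0) (P k))"
    using const[of p] 0 by (simp add: one_pCons)
  then show ?case by (intro exI[of _ "\<lambda>_. coeff p 0"])
next
  case (Suc N)
  let ?l = "coeff p (Suc N)"
  let ?r = "p - smult ?l (P (Suc N))"
  have "degree ?r \<le> N"
  proof (rule degree_le, intro allI impI)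
    fix i assume "N < i"
    then consider "i = Suc N" | "Suc N < i" by linarith
    then show "coeff ?r i = 0"
    proof cases
      case 1
      then show ?thesis using lead[of "Suc N"] deg[of "Suc N"] by simp
    next
      case 2
      then show ?thesis using Suc.prems deg[of "Suc N"] by (simp add: coeff_eq_0)
    qed
  qed
  then obtain c where c: "?r = (\<Sum>k\<le>N. smult (c k) (P k))"
    using Suc.IH by blast
  have "p = (\<Sum>k\<le>N. smult ((c(Suc N := ?l)) k) (P k)) + smult ?l (P (Suc N))"
    using c by (simp add: algebra_simps)
  then have "p = (\<Sum>k\<le>Suc N. smult ((c(Suc N := ?l)) k) (P k))"
    by simp
  then show ?case by blast
qed

lemma monic_orthogonalD:
  assumes "monic_orthogonal f P"
  shows "degree (P n) = n" and "lead_coeff (P n) = 1" and "m \<noteq> n \<Longrightarrow> f (P m) (P n) = 0"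
  using assms unfolding monic_orthogonal_def by blast+

locale symmetric_poly_form =
  fixes f :: "real poly \<Rightarrow> real poly \<Rightarrow> real"
  assumes add_left: "f (p + q) r = f p r + f q r"
    and smult_left: "f (smult s p) r = s * f p r"
    and sym: "f p q = f q p"
begin

lemma add_right: "f r (p + q) = f r p + f r q"
  by (metis add_left sym)

lemma smult_right: "f r (smult s p) = s * f r p"
  by (metis smult_left sym)

lemma zero_left: "f 0 r = 0"
  using smult_left[of 0 0 r] by simp

lemma zero_right: "f r 0 = 0"
  by (metis zero_left sym)

lemma diff_left: "f (p - q) r = f p r - f q r"
  using add_left[of "p - q" q r] by simp

lemma sum_left: "f (\<Sum>k\<in>A. g k) r = (\<Sum>k\<in>A. f (g k) r)"
  by (induction A rule: infinite_finite_induct) (simp_all add: zero_left add_left)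

lemma zero_ext_orthogonal:
  assumes "monic_orthogonal f P" and "i \<noteq> j"
  shows "f (zero_ext P i) (zero_ext P j) = 0"
  using assms by (auto simp: zero_ext_def monic_orthogonal_def zero_left zero_right)

lemma orthogonal_expansion:
  assumes orth: "monic_orthogonal f P" and nz: "\<And>n. f (P n) (P n) \<noteq> 0"
    and "degree p \<le> N"
  shows "p = (\<Sum>k\<le>N. smult (f p (P k) / f (P k) (P k)) (P k))"
proof -
  obtain c where c: "p = (\<Sum>k\<le>N. smult (c k) (P k))"
    using monic_sequence_spans[OF monic_orthogonalD(1)[OF orth] monic_orthogonalD(2)[OF orth]] \<open>degree p \<le> N\<close> by blast
  have "c j = f p (P j) / f (P j) (P j)" if "j \<le> N" for j
  proof -
    have "f p (P j) = (\<Sum>k\<le>N. c k * f (P k) (P j))"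
      by (subst c) (simp add: sum_left smult_left)
    also have "\<dots> = (\<Sum>k\<le>N. if k = j then c j * f (P j) (P j) else 0)"
      using orth by (intro sum.cong) (auto simp: monic_orthogonal_def)
    also have "\<dots> = c j * f (P j) (P j)"
      using that by simp
    finally show ?thesis using nz[of j] by simp
  qed
  then have "(\<Sum>k\<le>N. smult (c k) (P k)) = (\<Sum>k\<le>N. smult (f p (P k) / f (P k) (P k)) (P k))"
    by (intro sum.cong) auto
  with c show ?thesis by simp
qed

lemma orthogonal_to_lower_degree:
  assumes orth: "monic_orthogonal f P" and "degree p < n"
  shows "f p (P n) = 0"
proof -
  obtain c where c: "p = (\<Sum>k\<le>degree p. smult (c k) (P k))"
    using monic_sequence_spans[OF monic_orthogonalD(1)[OF orth] monic_orthogonalD(2)[OF orth]] by blast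
  show ?thesis
    using assms by (subst c) (auto simp: sum_left smult_left monic_orthogonal_def intro!: sum.neutral)
qed

text \<open>The difference of two monic polynomials of degree \<open>n\<close> has lower degree, hence pairs to zero
  with \<open>P n\<close>.\<close>
lemma monic_against_orthogonal:
  assumes orth: "monic_orthogonal f P" and "degree p = n" and "lead_coeff p = 1"
  shows "f p (P n) = f (P n) (P n)"
proof (cases "p = P n")
  case False
  have "degree (p - P n) < n"
  proof -
    have "degree (p - P n) \<le> n"
      using assms by (intro degree_diff_le) (auto simp: monic_orthogonal_def)
    moreover have "degree (p - P n) \<noteq> n"
    proof
      assume eq: "degree (p - P n) = n"
      have "coeff (p - P n) n = 0"
        using assms by (simp add: monic_orthogonal_def) metis
      then show False
        using eq False leading_coeff_0_iff[of "p - P n"] by simp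
    qed
    ultimately show ?thesis by simp
  qed
  then show ?thesis
    using orthogonal_to_lower_degree[OF orth, of "p - P n" n] by (simp add: diff_left)
qed simp

end

section \<open>The five-term recurrence for two linked forms\<close>

text \<open>The algebraic content of the double Geronimus transformation. With the measures stripped off,
  the identity \<open>link\<close> and the symmetry of both forms carry the recurrence, for any monic quadratic
  \<open>w\<close>.\<close>
locale linked_forms =
  f: symmetric_poly_form f + g: symmetric_poly_form g
  for f g :: "real poly \<Rightarrow> real poly \<Rightarrow> real" +
  fixes w :: "real poly" and P Q :: "nat \<Rightarrow> real poly" and B C :: "nat \<Rightarrow> real"
  assumes deg_w: "degree w = 2" and lead_w: "lead_coeff w = 1"
    and link: "g (w * p) q = f p q"
    and orth_P: "monic_orthogonal f P"
    and orth_Q: "monic_orthogonal g Q"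
    and norm_Q: "g (Q n) (Q n) \<noteq> 0"
    and conn: "connection_coeffs P Q B C"
begin

lemma deg_Q: "degree (Q n) = n" and lead_Q: "lead_coeff (Q n) = 1"
  using monic_orthogonalD[OF orth_Q] by blast+

lemma deg_w_mult: "p \<noteq> 0 \<Longrightarrow> degree (w * p) = degree p + 2"
  using deg_w lead_w degree_mult_eq[of w p] by force

lemma connection:
  assumes "n \<ge> 1"
  shows "Q n = zero_ext P (int n) + smult (B n) (zero_ext P (int n - 1))
    + smult (C n) (zero_ext P (int n - 2))"
  using conn assms by (simp add: connection_coeffs_def zero_ext_def)

lemma zero_ext_norm:
  "k \<le> n \<Longrightarrow>
    f (zero_ext P (int n - int k)) (zero_ext P (int n - int k)) = f (P (n - k)) (P (n - k))"
  by (simp add: zero_ext_def nat_diff_distrib)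

lemmas form_simps = f.add_left f.add_right f.smult_left f.smult_right
  f.zero_ext_orthogonal[OF orth_P]

text \<open>The monic polynomial \<open>w * P (k - 2)\<close> has the degree of \<open>Q k\<close> and can stand in for it; the
  link turns the pairing into one for \<open>f\<close>, where only the last term of the connection formula
  survives.\<close>
lemma norm_Q_eq:
  assumes "k \<ge> 2"
  shows "g (Q k) (Q k) = C k * f (P (k - 2)) (P (k - 2))"
proof -
  have P: "degree (P (k - 2)) = k - 2" "lead_coeff (P (k - 2)) = 1"
    using monic_orthogonalD[OF orth_P] by blast+
  then have "P (k - 2) \<noteq> 0" by auto
  then have "degree (w * P (k - 2)) = k"
    using assms P deg_w_mult by simp
  moreover have "lead_coeff (w * P (k - 2)) = 1"
    using lead_w P(2) by (simp only: lead_coeff_mult mult_1)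
  ultimately have "g (Q k) (Q k) = g (w * P (k - 2)) (Q k)"
    using g.monic_against_orthogonal[OF orth_Q] by metis
  also have "\<dots> = f (P (k - 2)) (Q k)"
    by (rule link)
  also have "P (k - 2) = zero_ext P (int k - 2)"
    using assms by (simp add: zero_ext_def nat_diff_distrib)
  also have "f (zero_ext P (int k - 2)) (Q k) = C k * f (P (k - 2)) (P (k - 2))"
    using assms zero_ext_norm[of 2 k] by (simp add: connection form_simps)
  finally show ?thesis .
qed

lemma pairing_next:
  assumes "n \<ge> 1"
  shows "f (Q n) (Q (n + 1)) = C (n + 1) * B n * f (P (n - 1)) (P (n - 1)) + B (n + 1) * f (P n) (P n)"
  using assms zero_ext_norm[of 0 n] zero_ext_norm[of 1 n]
  by (simp add: connection[of n] connection[of "Suc n"] form_simps algebra_simps)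

lemma pairing_self:
  assumes "n \<ge> 2"
  shows "f (Q n) (Q n) = f (P n) (P n) + (B n)\<^sup>2 * f (P (n - 1)) (P (n - 1))
    + (C n)\<^sup>2 * f (P (n - 2)) (P (n - 2))"
  using assms zero_ext_norm[of 0 n] zero_ext_norm[of 1 n] zero_ext_norm[of 2 n]
  by (simp add: connection form_simps power2_eq_square)

lemma pairing_previous:
  assumes "n \<ge> 2"
  shows "f (Q n) (Q (n - 1)) = B n * f (P (n - 1)) (P (n - 1))
    + B (n - 1) * C n * f (P (n - 2)) (P (n - 2))"
  using assms zero_ext_norm[of 1 n] zero_ext_norm[of 2 n]
  by (simp add: connection form_simps of_nat_diff)

lemma pairing_second_previous:
  assumes "n \<ge> 3"
  shows "f (Q n) (Q (n - 2)) = C n * f (P (n - 2)) (P (n - 2))"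
  using assms zero_ext_norm[of 2 n]
  by (simp add: connection form_simps of_nat_diff)

lemma pairing_far:
  assumes "k + 2 < n"
  shows "f (Q n) (Q k) = 0"
proof -
  have "Q k \<noteq> 0" using lead_Q[of k] by auto
  then have "degree (w * Q k) < n"
    using assms deg_w_mult deg_Q by simp
  then have "g (w * Q k) (Q n) = 0"
    by (rule g.orthogonal_to_lower_degree[OF orth_Q])
  then show ?thesis using link f.sym by metis
qed

lemma leading_pairing: "f (Q n) (Q (n + 2)) = g (Q (n + 2)) (Q (n + 2))"
proof -
  have "Q n \<noteq> 0" using lead_Q[of n] by auto
  then have "degree (w * Q n) = n + 2"
    using deg_w_mult deg_Q by simp
  moreover have "lead_coeff (w * Q n) = 1"
    using lead_w lead_Q[of n] by (simp only: lead_coeff_mult mult_1)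
  ultimately show ?thesis
    using g.monic_against_orthogonal[OF orth_Q] link by metis
qed

text \<open>The index is an integer so that all five terms have the same shape for every \<open>n\<close>; at a
  negative index the quotient is \<open>0 / 0 = 0\<close>.\<close>
definition rec_coeff :: "nat \<Rightarrow> int \<Rightarrow> real" where
  "rec_coeff n k = f (Q n) (zero_ext Q k) / g (zero_ext Q k) (zero_ext Q k)"

lemma rec_coeff_nat: "rec_coeff n (int k) = f (Q n) (Q k) / g (Q k) (Q k)"
  by (simp add: rec_coeff_def zero_ext_def)

theorem five_term_recurrence:
  "w * Q n = Q (n + 2) + smult (rec_coeff n (int n + 1)) (Q (n + 1))
    + smult (rec_coeff n (int n)) (Q n)
    + smult (rec_coeff n (int n - 1)) (zero_ext Q (int n - 1))
    + smult (rec_coeff n (int n - 2)) (zero_ext Q (int n - 2))"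
proof -
  define t where "t k = smult (rec_coeff n k) (zero_ext Q k)" for k
  have t_nat: "t (int k) = smult (rec_coeff n (int k)) (Q k)" for k
    by (simp add: t_def zero_ext_def)
  have t_neg: "t k = 0" if "k < 0" for k
    using that by (simp add: t_def zero_ext_def)
  have "Q n \<noteq> 0" using lead_Q[of n] by auto
  then have "degree (w * Q n) \<le> n + 2"
    using deg_w_mult deg_Q by simp
  then have "w * Q n = (\<Sum>k\<le>n + 2. t (int k))"
    using g.orthogonal_expansion[OF orth_Q norm_Q, of "w * Q n" "n + 2"]
    by (simp only: link t_nat rec_coeff_nat)
  also have "\<dots> = (\<Sum>k<n - 2. t (int k)) + (\<Sum>k = n - 2..n + 2. t (int k))"
  proof -
    have "{..n + 2} = {..<n - 2} \<union> {n - 2..n + 2}" by auto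
    then show ?thesis by (simp only:) (rule sum.union_disjoint, auto)
  qed
  also have "(\<Sum>k<n - 2. t (int k)) = 0"
    by (intro sum.neutral) (auto simp: t_nat rec_coeff_nat pairing_far)
  also have "(\<Sum>k = n - 2..n + 2. t (int k))
      = t (int n + 2) + t (int n + 1) + t (int n) + t (int n - 1) + t (int n - 2)"
  proof -
    \<comment> \<open>For \<open>n < 2\<close> the truncated lower bound drops exactly the terms at negative indices.\<close>
    consider "n = 0" | "n = 1" | m where "n = m + 2"
      by (metis One_nat_def Suc_1 add_2_eq_Suc' not0_implies_Suc)
    then show ?thesis
      by cases (simp_all add: t_neg numeral_eq_Suc algebra_simps)
  qed
  also have "t (int n + 2) = Q (n + 2)"
    using t_nat[of "n + 2"] rec_coeff_nat[of n "n + 2"] leading_pairing[of n] norm_Q[of "n + 2"]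
    by (simp add: add.commute)
  also have "t (int n + 1) = smult (rec_coeff n (int n + 1)) (Q (n + 1))"
    using t_nat[of "n + 1"] by (simp add: add.commute)
  finally show ?thesis
    by (simp add: t_nat) (simp add: t_def)
qed

lemma rec_coeff_next:
  assumes "n \<ge> 1"
  shows "rec_coeff n (int n + 1) =
    (C (n + 1) * B n * f (P (n - 1)) (P (n - 1)) + B (n + 1) * f (P n) (P n))
    / (C (n + 1) * f (P (n - 1)) (P (n - 1)))"
  using rec_coeff_nat[of n "n + 1"] norm_Q_eq[of "n + 1"] pairing_next[OF assms] assms
  by (simp add: add.commute)

lemma rec_coeff_self:
  assumes "n \<ge> 2"
  shows "rec_coeff n (int n) =
    (f (P n) (P n) + (B n)\<^sup>2 * f (P (n - 1)) (P (n - 1)) + (C n)\<^sup>2 * f (P (n - 2)) (P (n - 2)))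
    / (C n * f (P (n - 2)) (P (n - 2)))"
  using rec_coeff_nat norm_Q_eq[OF assms] pairing_self[OF assms] by simp

lemma rec_coeff_previous:
  assumes "n \<ge> 3"
  shows "rec_coeff n (int n - 1) =
    (B n * f (P (n - 1)) (P (n - 1)) + B (n - 1) * C n * f (P (n - 2)) (P (n - 2)))
    / (C (n - 1) * f (P (n - 3)) (P (n - 3)))"
  using rec_coeff_nat[of n "n - 1"] norm_Q_eq[of "n - 1"] pairing_previous[of n] assms
  by (simp add: of_nat_diff numeral_3_eq_3)

lemma rec_coeff_second_previous:
  assumes "n \<ge> 4"
  shows "rec_coeff n (int n - 2) =
    (C n * f (P (n - 2)) (P (n - 2))) / (C (n - 2) * f (P (n - 4)) (P (n - 4)))"
  using rec_coeff_nat[of n "n - 2"] norm_Q_eq[of "n - 2"] pairing_second_previous[of n] assms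
  by (simp add: of_nat_diff)

end

section \<open>The two forms given by the measures\<close>

lemma closed_measure_support: "closed (measure_support M)"
proof -
  have "open (- measure_support M)"
  proof (subst open_subopen, intro ballI)
    fix x assume "x \<in> - measure_support M"
    then obtain U where "open U" "x \<in> U" "\<not> emeasure M U > 0"
      by (auto simp: measure_support_def)
    then show "\<exists>T. open T \<and> x \<in> T \<and> T \<subseteq> - measure_support M"
      by (intro exI[of _ U]) (auto simp: measure_support_def)
  qed
  then show ?thesis by (simp add: closed_def)
qed

lemma integrable_poly:
  fixes p :: "real poly"
  assumes "\<And>n::nat. integrable M (\<lambda>x. x ^ n)"
  shows "integrable M (poly p)"
proof -
  have "integrable M (\<lambda>x. \<Sum>i\<le>degree p. coeff p i * x ^ i)"
    using assms by (intro Bochner_Integration.integrable_sum) auto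
  then show ?thesis by (simp add: poly_altdef[abs_def])
qed

lemma set_integrable_poly:
  fixes p :: "real poly"
  assumes "\<And>n::nat. integrable M (\<lambda>x. x ^ n)" and "A \<in> sets M"
  shows "set_integrable M A (poly p)"
  unfolding set_integrable_def
  using integrable_mult_indicator[OF assms(2) integrable_poly[OF assms(1)]] by simp

lemma symmetric_poly_form_set_integral:
  assumes "\<And>p :: real poly. set_integrable M A (poly p)"
  shows "symmetric_poly_form (\<lambda>p q. LINT x:A|M. poly p x * poly q x)"
proof
  have int: "set_integrable M A (\<lambda>x. poly p x * poly q x)" for p q :: "real poly"
    using assms[of "p * q"] by (simp add: poly_mult[abs_def])
  fix p q r :: "real poly" and s :: real
  show "(LINT x:A|M. poly (p + q) x * poly r x)
      = (LINT x:A|M. poly p x * poly r x) + (LINT x:A|M. poly q x * poly r x)"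
    using set_integral_add(2)[OF int[of p r] int[of q r]] by (simp add: distrib_right)
  show "(LINT x:A|M. poly (smult s p) x * poly r x) = s * (LINT x:A|M. poly p x * poly r x)"
    by (simp add: mult.assoc)
  show "(LINT x:A|M. poly p x * poly q x) = (LINT x:A|M. poly q x * poly p x)"
    by (simp add: mult.commute)
qed

text \<open>The weight \<open>1 / (x - a)\<^sup>2\<close> is bounded away from \<open>a\<close>, so on a set that keeps a positive distance
  from \<open>a\<close> the integrability of polynomials passes from the density back to \<open>N\<close>. Near \<open>a\<close> itself
  nothing is known about \<open>N\<close>.\<close>
lemma set_integrable_poly_of_density:
  fixes p :: "real poly"
  assumes mom: "\<And>n::nat. integrable M (\<lambda>x. x ^ n)"
    and N: "sets N = sets borel" and dens: "density N (\<lambda>x. ennreal ((x - a)\<^sup>2)) = M"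
    and A: "closed A" "a \<notin> A"
  shows "set_integrable N A (poly p)"
proof -
  obtain \<delta> where \<delta>: "\<delta> > 0" "\<And>x. x \<in> A \<Longrightarrow> \<delta> \<le> dist a x"
    using separate_point_closed[OF A] by blast
  have [measurable_cong]: "sets N = sets borel" "sets M = sets borel"
    unfolding dens[symmetric] by (simp_all add: N)
  have [measurable]: "A \<in> sets borel" using A by simp
  have [measurable]: "poly p \<in> borel_measurable borel"
    by (intro borel_measurable_continuous_onI continuous_intros)
  define h where "h x = indicator A x * (poly p x / (x - a)\<^sup>2)" for x :: real
  have [measurable]: "h \<in> borel_measurable borel"
    unfolding h_def by measurable
  have "integrable M h"
  proof (rule Bochner_Integration.integrable_bound)
    show "integrable M (\<lambda>x. poly p x / \<delta>\<^sup>2)"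
      using integrable_poly[OF mom, of p] by simp
    show "AE x in M. norm (h x) \<le> norm (poly p x / \<delta>\<^sup>2)"
    proof (intro AE_I2)
      fix x
      show "norm (h x) \<le> norm (poly p x / \<delta>\<^sup>2)"
      proof (cases "x \<in> A")
        case True
        then have "\<delta>\<^sup>2 \<le> \<bar>x - a\<bar>\<^sup>2"
          using \<delta>(1) \<delta>(2)[OF True]
          by (intro power_mono) (simp_all add: dist_real_def abs_minus_commute)
        moreover have "x \<noteq> a"
          using True A(2) by blast
        ultimately show ?thesis
          using True \<delta>(1) by (auto simp: h_def intro!: divide_left_mono)
      qed (simp add: h_def)
    qed
  qed measurable
  then have "integrable N (\<lambda>x. (x - a)\<^sup>2 *\<^sub>R h x)"
    unfolding dens[symmetric] by (simp add: integrable_density)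
  also have "(\<lambda>x. (x - a)\<^sup>2 *\<^sub>R h x) = (\<lambda>x. indicator A x *\<^sub>R poly p x)"
    using A(2) by (auto simp: h_def fun_eq_iff indicator_def)
  finally show ?thesis by (simp add: set_integrable_def)
qed

lemma inner_M1:
  "(vector [u, v] :: real^2) \<bullet> (M1 E N b c d *v vector [y, z]) =
    u * ((b - (LINT x:E|N. 1)) * y + (c - (LINT x:E|N. x)) * z)
    + v * ((c - (LINT x:E|N. x)) * y + (d - (LINT x:E|N. x\<^sup>2)) * z)"
  by (simp add: M1_def inner_vec_def matrix_vector_mult_def sum_2)

lemma symmetric_poly_form_inner_gg:
  assumes "\<And>p :: real poly. set_integrable N E (poly p)"
  shows "symmetric_poly_form (inner_gg E N a b c d)"
proof -
  interpret I: symmetric_poly_form "\<lambda>p q. LINT x:E|N. poly p x * poly q x"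
    using assms by (rule symmetric_poly_form_set_integral)
  show ?thesis
  proof
    fix p q r :: "real poly" and s :: real
    show "inner_gg E N a b c d (p + q) r = inner_gg E N a b c d p r + inner_gg E N a b c d q r"
      unfolding inner_gg_def inner_M1 I.add_left by (simp add: pderiv_add algebra_simps)
    show "inner_gg E N a b c d (smult s p) r = s * inner_gg E N a b c d p r"
      unfolding inner_gg_def inner_M1 I.smult_left by (simp add: pderiv_smult algebra_simps)
    show "inner_gg E N a b c d p q = inner_gg E N a b c d q p"
      unfolding inner_gg_def inner_M1 I.sym[of p q] by (simp add: algebra_simps)
  qed
qed

lemma inner_gg_square_factor:
  assumes N: "sets N = sets borel" and dens: "density N (\<lambda>x. ennreal ((x - a)\<^sup>2)) = M"
  shows "inner_gg (measure_support M) N a b c d ([:- a, 1:]\<^sup>2 * p) q = inner0 M p q"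
proof -
  let ?E = "measure_support M"
  have [measurable_cong]: "sets N = sets borel" by (fact N)
  have [measurable]: "?E \<in> sets borel"
    using closed_measure_support[of M] by simp
  have [measurable]: "poly p \<in> borel_measurable borel" for p :: "real poly"
    by (intro borel_measurable_continuous_onI continuous_intros)
  have "poly ([:- a, 1:]\<^sup>2 * p) a = 0" "poly (pderiv ([:- a, 1:]\<^sup>2 * p)) a = 0"
    unfolding power2_eq_square pderiv_mult poly_add poly_mult by simp_all
  then have "inner_gg ?E N a b c d ([:- a, 1:]\<^sup>2 * p) q
      = (LINT x:?E|N. poly ([:- a, 1:]\<^sup>2 * p) x * poly q x)"
    unfolding inner_gg_def inner_M1 by simp
  also have "\<dots> = (\<integral>x. (x - a)\<^sup>2 *\<^sub>R (indicator ?E x *\<^sub>R (poly p x * poly q x)) \<partial>N)"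
    unfolding set_lebesgue_integral_def
    by (intro Bochner_Integration.integral_cong) (simp_all add: algebra_simps power2_eq_square)
  also have "\<dots> = (\<integral>x. indicator ?E x *\<^sub>R (poly p x * poly q x)
      \<partial>density N (\<lambda>x. ennreal ((x - a)\<^sup>2)))"
    by (subst integral_density) auto
  also have "\<dots> = inner0 M p q"
    unfolding dens inner0_def set_lebesgue_integral_def ..
  finally show ?thesis .
qed

section \<open>The double Geronimus polynomials\<close>

theorem proposition2p1:
  fixes \<mu> \<mu>gg :: "real measure" and E :: "real set" and a b c d :: real
    and P Pgg :: "nat \<Rightarrow> real poly" and B C :: "nat \<Rightarrow> real"
  assumes "sets \<mu> = sets borel"
    and "E = measure_support \<mu>" and "infinite E"
    and "\<And>n::nat. integrable \<mu> (\<lambda>x. x ^ n)"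
    and "a \<notin> E"
    and "monic_orthogonal (inner0 \<mu>) P"
    and "sets \<mu>gg = sets borel"
    and "density \<mu>gg (\<lambda>x. ennreal ((x - a)\<^sup>2)) = \<mu>"
    and "monic_orthogonal (inner_gg E \<mu>gg a b c d) Pgg"
    and "\<And>n. inner_gg E \<mu>gg a b c d (Pgg n) (Pgg n) \<noteq> 0"
    and "connection_coeffs P Pgg B C"
  shows "\<exists>\<alpha> :: nat \<Rightarrow> int \<Rightarrow> real.
    (\<forall>n. [:- a, 1:]\<^sup>2 * Pgg n =
        Pgg (n + 2)
        + smult (\<alpha> (n + 1) (int n + 1)) (Pgg (n + 1))
        + smult (\<alpha> (n + 1) (int n)) (Pgg n)
        + smult (\<alpha> (n + 1) (int n - 1)) (zero_ext Pgg (int n - 1))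
        + smult (\<alpha> (n + 1) (int n - 2)) (zero_ext Pgg (int n - 2))) \<and>
    (\<forall>n\<ge>1. \<alpha> (n + 1) (int n + 1) =
        (C (n + 1) * B n * sqnorm0 \<mu> (P (n - 1)) + B (n + 1) * sqnorm0 \<mu> (P n))
        / (C (n + 1) * sqnorm0 \<mu> (P (n - 1)))) \<and>
    (\<forall>n\<ge>2. \<alpha> (n + 1) (int n) =
        (sqnorm0 \<mu> (P n) + (B n)\<^sup>2 * sqnorm0 \<mu> (P (n - 1)) + (C n)\<^sup>2 * sqnorm0 \<mu> (P (n - 2)))
        / (C n * sqnorm0 \<mu> (P (n - 2)))) \<and>
    (\<forall>n\<ge>3. \<alpha> (n + 1) (int n - 1) =
        (B n * sqnorm0 \<mu> (P (n - 1)) + B (n - 1) * C n * sqnorm0 \<mu> (P (n - 2)))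
        / (C (n - 1) * sqnorm0 \<mu> (P (n - 3)))) \<and>
    (\<forall>n\<ge>4. \<alpha> (n + 1) (int n - 2) =
        (C n * sqnorm0 \<mu> (P (n - 2))) / (C (n - 2) * sqnorm0 \<mu> (P (n - 4))))"
proof -
  have closed: "closed E"
    using assms(2) closed_measure_support by simp
  have "inner0 \<mu> = (\<lambda>p q. LINT x:E|\<mu>. poly p x * poly q x)"
    by (simp add: fun_eq_iff inner0_def assms(2))
  moreover have "E \<in> sets \<mu>"
    using closed assms(1) by simp
  ultimately have f: "symmetric_poly_form (inner0 \<mu>)"
    using symmetric_poly_form_set_integral[OF set_integrable_poly[OF assms(4)]] by simp
  have g: "symmetric_poly_form (inner_gg E \<mu>gg a b c d)"
    using set_integrable_poly_of_density[OF assms(4) assms(7,8) closed assms(5)]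
    by (rule symmetric_poly_form_inner_gg)
  interpret linked_forms "inner0 \<mu>" "inner_gg E \<mu>gg a b c d" "[:- a, 1:]\<^sup>2" P Pgg B C
  proof (intro linked_forms.intro linked_forms_axioms.intro f g)
    show "degree ([:- a, 1:]\<^sup>2) = 2" "lead_coeff ([:- a, 1:]\<^sup>2) = 1"
      by (simp_all add: power2_eq_square)
    show "inner_gg E \<mu>gg a b c d ([:- a, 1:]\<^sup>2 * p) q = inner0 \<mu> p q" for p q
      unfolding assms(2) by (rule inner_gg_square_factor[OF assms(7,8)])
  qed (fact assms)+
  show ?thesis
    unfolding sqnorm0_def
    using five_term_recurrence rec_coeff_next rec_coeff_self rec_coeff_previous
      rec_coeff_second_previous
    by (intro exI[of _ "\<lambda>m. rec_coeff (m - 1)"]) simp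
qed

end
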